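(* Let $\alpha>0$, $K_\Sigma>0$, let $Z$ have the standard normal distribution, and let $\inf_{\widetilde p_n}$ denote the infimum over all estimators $\widetilde p_n$ of $p$ based on the sample $X_1,\dots,X_n$. Then, for $n\ge2$, $$\inf_{\widetilde p_n}\ \sup_{f\in\Sigma(\alpha,K_\Sigma),\,p\in[0,1)}\mathbb E_{p,f}\big[(\widetilde p_n-p)^2\big]\gtrsim(\log n)^{-(\alpha+1/2)}.$$
   Context: Model: $X_1,\dots,X_n$ are i.i.d. copies of $X=Y+Z$, where $Y$ and $Z$ are independent, $Y=AV$ with $A$ and $V$ independent, $A$ Bernoulli with $P(A=1)=1-p$, and $V$ has probability density $f$ on $\mathbb R$. $\mathbb E_{p,f}$ denotes expectation under the parameter $(p,f)$. $\phi_f(t)=\int_{-\infty}^\infty e^{itx}f(x)\,dx$. Class of densities: $\Sigma(\alpha,K_\Sigma)=\{f \text{ probability density}:\int_{-\infty}^\infty|\phi_f(t)|^2(1+|t|^{2\alpha})\,dt\le K_\Sigma\}$. $a_n\gtrsim b_n$ means $a_n\ge c\,b_n$ for all $n\ge 2$, with a constant $c>0$ not depending on $n$. *)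

theory Defs
  imports "HOL-Probability.Probability"
begin

definition prob_density :: "(real \<Rightarrow> real) \<Rightarrow> bool" where
  "prob_density f \<longleftrightarrow>
     f \<in> borel_measurable borel \<and> (\<forall>x. 0 \<le> f x) \<and> (\<integral>\<^sup>+x. ennreal (f x) \<partial>lborel) = 1"

definition phi :: "(real \<Rightarrow> real) \<Rightarrow> real \<Rightarrow> complex" where
  "phi f t = (CLINT x|lborel. iexp (t * x) * complex_of_real (f x))"

(* The integral is taken in [0,\<infinity>], so a divergent integral excludes f. *)
definition Sobolev_densities :: "real \<Rightarrow> real \<Rightarrow> (real \<Rightarrow> real) set" where
  "Sobolev_densities \<alpha> K = {f. prob_density f \<and>
     (\<integral>\<^sup>+t. ennreal ((cmod (phi f t))\<^sup>2 * (1 + \<bar>t\<bar> powr (2 * \<alpha>))) \<partial>lborel) \<le> ennreal K}"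

definition A_law :: "real \<Rightarrow> real measure" where
  "A_law p = distr (measure_pmf (bernoulli_pmf (1 - p))) borel of_bool"

(* Law of Y = A V. *)
definition Y_law :: "real \<Rightarrow> (real \<Rightarrow> real) \<Rightarrow> real measure" where
  "Y_law p f = distr (A_law p \<Otimes>\<^sub>M density lborel f) borel (\<lambda>(a, v). a * v)"

(* Law of X = Y + Z, where N is the law of Z. *)
definition X_law :: "real measure \<Rightarrow> real \<Rightarrow> (real \<Rightarrow> real) \<Rightarrow> real measure" where
  "X_law N p f = convolution (Y_law p f) N"

lemma (in prob_space) distr_X_law:
  fixes A V Z :: "'a \<Rightarrow> real"
  assumes A: "distr M borel A = A_law p"
    and V: "distr M borel V = density lborel f"
    and Z: "distr M borel Z = N"
    and AV: "indep_var borel A borel V"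
    and YZ: "indep_var borel (\<lambda>\<omega>. A \<omega> * V \<omega>) borel Z"
  shows "distr M borel (\<lambda>\<omega>. A \<omega> * V \<omega> + Z \<omega>) = X_law N p f"
proof -
  have [measurable]: "A \<in> borel_measurable M" "V \<in> borel_measurable M"
    and joint: "distr M borel A \<Otimes>\<^sub>M distr M borel V =
      distr M (borel \<Otimes>\<^sub>M borel) (\<lambda>\<omega>. (A \<omega>, V \<omega>))"
    using AV by (auto simp: indep_var_distribution_eq)
  have [measurable]: "Z \<in> borel_measurable M"
    using YZ by (auto simp: indep_var_distribution_eq)
  have "Y_law p f = distr (distr M (borel \<Otimes>\<^sub>M borel) (\<lambda>\<omega>. (A \<omega>, V \<omega>))) borel (\<lambda>(a, v). a * v)"
    unfolding Y_law_def A[symmetric] V[symmetric] joint ..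
  also have "\<dots> = distr M borel (\<lambda>\<omega>. A \<omega> * V \<omega>)"
    by (subst distr_distr) (auto simp: comp_def)
  finally show ?thesis
    unfolding X_law_def Z[symmetric]
    using sum_indep_random_variable[OF YZ] by simp
qed

definition sample_law :: "real measure \<Rightarrow> nat \<Rightarrow> real \<Rightarrow> (real \<Rightarrow> real) \<Rightarrow> (nat \<Rightarrow> real) measure" where
  "sample_law N n p f = (\<Pi>\<^sub>M i\<in>{1..n}. X_law N p f)"

definition estimators :: "nat \<Rightarrow> ((nat \<Rightarrow> real) \<Rightarrow> real) set" where
  "estimators n = borel_measurable (\<Pi>\<^sub>M i\<in>{1..n}. (borel :: real measure))"

definition sq_risk ::
  "real measure \<Rightarrow> nat \<Rightarrow> ((nat \<Rightarrow> real) \<Rightarrow> real) \<Rightarrow> (real \<Rightarrow> real) \<Rightarrow> real \<Rightarrow> ennreal" where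
  "sq_risk N n T f p = (\<integral>\<^sup>+x. ennreal ((T x - p)\<^sup>2) \<partial>sample_law N n p f)"

end

theory Submission
  imports Defs
begin

text \<open>
  A two-point argument. Let \<open>F\<^sub>L\<close> be the Fejer density with characteristic function
  \<open>(1 - |t|/L)\<^sub>+\<close>. In both hypotheses \<open>Y\<close> has the component \<open>F\<^sub>m / 2\<close> with \<open>m\<close> fixed and small.
  The remaining mass is \<open>(1/2 - \<delta>) \<cdot> (atom at 0) + \<delta> F\<^sub>M\<close> in the first hypothesis and
  \<open>(1/2 - 2\<delta>) \<cdot> (atom at 0) + 2\<delta> F\<^bsub>2M\<^esub>\<close> in the second. The Sobolev bound holds as long as
  \<open>\<delta>\<^sup>2 M\<^bsup>2\<alpha>+1\<^esup>\<close> is small. Since \<open>2F\<^bsub>2M\<^esub> - F\<^sub>M\<close> (the de la Vallee Poussin kernel) has Fourier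
  transform \<open>1\<close> on \<open>[-M, M]\<close>, the two characteristic functions agree there, and after Gaussian
  smoothing the densities of \<open>X\<close> differ uniformly by at most \<open>\<surd>2 exp (-M\<^sup>2/4)\<close>.
  With \<open>M\<^sup>2\<close> a large multiple of \<open>log n\<close> and the \<open>O(1/R)\<close> tails of the laws, the total variation
  distance is below \<open>1/(2n)\<close>, so the \<open>n\<close>-fold products are not separated, although the values of
  \<open>p\<close> differ by \<open>\<delta>\<close>, where \<open>\<delta>\<^sup>2\<close> is of order \<open>(log n)\<^bsup>-(\<alpha>+1/2)\<^esup>\<close>.
\<close>

section \<open>Fejer densities\<close>

text \<open>The value \<open>\<pi>\<close> of this integral is never needed: scaling alone yields the
  characteristic function of the normalised kernel.\<close>

definition fejer_mass :: real where
  "fejer_mass = (\<integral>x. (1 - cos x) / x\<^sup>2 \<partial>lborel)"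

text \<open>The Fejer kernel with \<open>fejer_mass\<close> standing for pi. Division by 0 gives 0,
  so the value at 0 is 0; this changes only a null set, and pointwise bounds of the form B/x^2 stay
  true at 0.\<close>

definition fejer :: "real \<Rightarrow> real \<Rightarrow> real" where
  "fejer L x = (1 - cos (L * x)) / (fejer_mass * L * x\<^sup>2)"

lemma one_minus_cos_le: "1 - cos x \<le> x\<^sup>2 / 2" for x :: real
proof -
  have "\<bar>sin (x/2)\<bar> \<le> \<bar>x/2\<bar>" by (rule abs_sin_x_le_abs_x)
  then have "(sin (x/2))\<^sup>2 \<le> (x/2)\<^sup>2" by (rule abs_le_square_iff[THEN iffD1])
  moreover have "cos x = 1 - 2 * (sin (x/2))\<^sup>2" using cos_double_sin[of "x/2"] by simp
  ultimately show ?thesis by (simp add: power2_eq_square)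
qed

text \<open>Two bounds are fused: x^2/2 controls \<open>1 - cos x\<close> near 0, and 2 controls it
  at infinity. Adding the first to x^2 times the second gives a single integrable majorant.\<close>

lemma one_minus_cos_div_square_le: "(1 - cos x) / x\<^sup>2 \<le> 4 / (1 + x\<^sup>2)" for x :: real
proof (cases "x = 0")
  case False
  have "(1 - cos x) * x\<^sup>2 \<le> 2 * x\<^sup>2"
    using cos_ge_minus_one[of x] by (intro mult_right_mono) auto
  then have "(1 - cos x) + (1 - cos x) * x\<^sup>2 \<le> x\<^sup>2 / 2 + 2 * x\<^sup>2"
    by (intro add_mono one_minus_cos_le)
  also have "\<dots> \<le> 4 * x\<^sup>2" by simp
  finally have "(1 - cos x) * (1 + x\<^sup>2) \<le> 4 * x\<^sup>2" by (simp only: distrib_left mult_1_right)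
  moreover have "0 < 1 + x\<^sup>2" by (simp add: add_pos_nonneg)
  ultimately show ?thesis using False by (simp add: field_simps)
qed simp

lemma integrable_inverse_one_plus_square: "integrable lborel (\<lambda>x::real. 1 / (1 + x\<^sup>2))"
proof (rule integrableI_nonneg)
  let ?f = "\<lambda>x::real. ennreal (1 / (1 + x\<^sup>2))"
  \<comment> \<open>The antiderivative arctan settles one half-line; reflection covers the other,
    and counting 0 twice is harmless for an upper bound.\<close>
  have half: "(\<integral>\<^sup>+x. ennreal (1 / (1 + x\<^sup>2)) * indicator {0..} x \<partial>lborel) = ennreal (pi / 2 - arctan 0)"
  proof (rule nn_integral_FTC_atLeast)
    show "(arctan \<longlongrightarrow> pi / 2) at_top" by (rule tendsto_arctan_at_top)
  qed (auto intro!: derivative_eq_intros simp: field_simps add_nonneg_eq_0_iff)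
  have "(\<integral>\<^sup>+x. ?f x \<partial>lborel) \<le> (\<integral>\<^sup>+x. ?f x * indicator {0..} x + ?f x * indicator {0..} (-x) \<partial>lborel)"
    by (intro nn_integral_mono) (auto split: split_indicator)
  also have "\<dots> = (\<integral>\<^sup>+x. ?f x * indicator {0..} x \<partial>lborel) + (\<integral>\<^sup>+x. ?f x * indicator {0..} (-x) \<partial>lborel)"
    by (rule nn_integral_add) auto
  also have "(\<integral>\<^sup>+x. ?f x * indicator {0..} (-x) \<partial>lborel) = (\<integral>\<^sup>+x. ?f x * indicator {0..} x \<partial>lborel)"
    by (subst (2) nn_integral_real_affine[where c="-1" and t=0]) auto
  finally show "(\<integral>\<^sup>+x. ?f x \<partial>lborel) < \<infinity>"
    unfolding half by (rule le_less_trans) simp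
qed auto

lemma integrable_one_minus_cos_div_square: "integrable lborel (\<lambda>x::real. (1 - cos x) / x\<^sup>2)"
  using one_minus_cos_div_square_le
  by (intro Bochner_Integration.integrable_bound[OF
        integrable_mult_right[OF integrable_inverse_one_plus_square, of 4]] AE_I2) auto

text \<open>Scaling: the squared denominator contributes a^2 and the Jacobian 1/|a|, which leaves
  |a|.\<close>

lemma has_bochner_integral_one_minus_cos:
  "has_bochner_integral lborel (\<lambda>x. (1 - cos (a * x)) / x\<^sup>2) (\<bar>a\<bar> * fejer_mass)"
proof (cases "a = 0")
  case False
  have "has_bochner_integral lborel (\<lambda>x. (1 - cos (0 + a * x)) / (0 + a * x)\<^sup>2) (fejer_mass /\<^sub>R \<bar>a\<bar>)"
    unfolding fejer_mass_def
    by (rule lborel_has_bochner_integral_real_affine_iff[THEN iffD1, OF False])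
       (rule has_bochner_integral_integrable[OF integrable_one_minus_cos_div_square])
  from has_bochner_integral_mult_right[OF this, of "a\<^sup>2"]
  have "has_bochner_integral lborel (\<lambda>x. a\<^sup>2 * ((1 - cos (a * x)) / (a * x)\<^sup>2))
      (a\<^sup>2 * (fejer_mass /\<^sub>R \<bar>a\<bar>))" by simp
  moreover have "a\<^sup>2 * ((1 - cos (a * x)) / (a * x)\<^sup>2) = (1 - cos (a * x)) / x\<^sup>2" for x
    using False by (simp add: power_mult_distrib)
  moreover have "a\<^sup>2 * (fejer_mass /\<^sub>R \<bar>a\<bar>) = \<bar>a\<bar> * fejer_mass"
    using False by (simp add: divide_inverse[symmetric] power2_eq_square abs_if field_simps)
  ultimately show ?thesis by (simp only:)
qed (simp add: has_bochner_integral_zero)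

text \<open>A nonnegative integrand with integral 0 vanishes almost everywhere, but cos stays below
  1 on (0,1), a set of positive measure.\<close>

lemma fejer_mass_pos: "0 < fejer_mass"
proof -
  have "\<bar>1\<bar> * fejer_mass \<noteq> 0"
  proof
    assume "\<bar>1\<bar> * fejer_mass = 0"
    then have "AE x::real in lborel. cos x = 1 \<or> x = 0"
      using integral_nonneg_eq_0_iff_AE[OF integrable_one_minus_cos_div_square]
      by (simp add: fejer_mass_def)
    then have "AE x::real in lborel. x \<notin> {0<..<1}"
    proof eventually_elim
      case (elim x)
      show ?case
      proof
        assume x: "x \<in> {0<..<1}"
        then have "cos x < cos 0" using pi_gt3 by (intro cos_monotone_0_pi) auto
        with x elim show False by auto
      qed
    qed
    then have "{0<..<1::real} \<in> null_sets lborel" by (subst AE_iff_null_sets) auto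
    then show False by (simp add: null_sets_def)
  qed
  moreover have "0 \<le> fejer_mass" unfolding fejer_mass_def by (intro Bochner_Integration.integral_nonneg) auto
  ultimately show ?thesis by simp
qed

lemma fejer_nonneg: "0 < L \<Longrightarrow> 0 \<le> fejer L x"
  unfolding fejer_def using fejer_mass_pos by simp

lemma borel_measurable_fejer [measurable]: "fejer L \<in> borel_measurable borel"
  unfolding fejer_def[abs_def] by measurable

lemma fejer_le:
  assumes "0 < L"
  shows "fejer L x \<le> 2 / (fejer_mass * L) / x\<^sup>2"
proof -
  have "fejer L x = (1 - cos (L * x)) / (fejer_mass * L) / x\<^sup>2" by (simp add: fejer_def)
  also have "\<dots> \<le> 2 / (fejer_mass * L) / x\<^sup>2"
    using assms fejer_mass_pos cos_ge_minus_one[of "L * x"] by (intro divide_right_mono) auto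
  finally show ?thesis .
qed

text \<open>By the addition formulas, cos(tx) (1 - cos(Lx)) is the mean of 1 - cos(ax) over a = t+L
  and a = t-L, minus its value at a = t. Integration turns this into a second difference of the
  absolute value, which is a triangle.\<close>

lemma has_bochner_integral_cos_fejer:
  assumes "0 < L"
  shows "has_bochner_integral lborel (\<lambda>x. cos (t * x) * fejer L x) (max 0 (1 - \<bar>t\<bar> / L))"
proof -
  let ?J = "\<lambda>a x. (1 - cos (a * x)) / x\<^sup>2"
  have "has_bochner_integral lborel
    (\<lambda>x. (?J (t + L) x / 2 + ?J (t - L) x / 2 - ?J t x) / (fejer_mass * L))
    ((\<bar>t + L\<bar> * fejer_mass / 2 + \<bar>t - L\<bar> * fejer_mass / 2 - \<bar>t\<bar> * fejer_mass) / (fejer_mass * L))"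
    by (intro has_bochner_integral_divide_zero has_bochner_integral_diff
        has_bochner_integral_add has_bochner_integral_one_minus_cos)
  moreover have "(?J (t + L) x / 2 + ?J (t - L) x / 2 - ?J t x) / (fejer_mass * L)
      = cos (t * x) * fejer L x" for x
  proof -
    have "cos ((t + L) * x) = cos (t * x) * cos (L * x) - sin (t * x) * sin (L * x)"
      and "cos ((t - L) * x) = cos (t * x) * cos (L * x) + sin (t * x) * sin (L * x)"
      by (simp_all add: distrib_right left_diff_distrib cos_add cos_diff)
    then have "(1 - cos ((t + L) * x)) / 2 + (1 - cos ((t - L) * x)) / 2 - (1 - cos (t * x))
       = cos (t * x) * (1 - cos (L * x))" by (simp only:) (simp add: field_simps)
    moreover have "?J (t + L) x / 2 + ?J (t - L) x / 2 - ?J t x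
      = ((1 - cos ((t + L) * x)) / 2 + (1 - cos ((t - L) * x)) / 2 - (1 - cos (t * x))) / x\<^sup>2"
      by (simp add: add_divide_distrib diff_divide_distrib)
    ultimately show ?thesis unfolding fejer_def by (simp add: ac_simps)
  qed
  moreover have "(\<bar>t + L\<bar> * fejer_mass / 2 + \<bar>t - L\<bar> * fejer_mass / 2 - \<bar>t\<bar> * fejer_mass) / (fejer_mass * L)
      = max 0 (1 - \<bar>t\<bar> / L)"
  proof -
    have "(\<bar>t + L\<bar> * fejer_mass / 2 + \<bar>t - L\<bar> * fejer_mass / 2 - \<bar>t\<bar> * fejer_mass)
       = fejer_mass * max 0 (L - \<bar>t\<bar>)"
      using assms by (auto simp: max_def abs_if field_simps)
    then show ?thesis using assms fejer_mass_pos by (auto simp: max_def field_simps)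
  qed
  ultimately show ?thesis by simp
qed

lemma has_bochner_integral_fejer: "0 < L \<Longrightarrow> has_bochner_integral lborel (fejer L) 1"
  using has_bochner_integral_cos_fejer[of L 0] by simp

lemma integrable_fejer: "0 < L \<Longrightarrow> integrable lborel (fejer L)"
  using has_bochner_integral_fejer has_bochner_integral_iff by blast

lemma integrable_iexp_mult:
  fixes f :: "real \<Rightarrow> real"
  assumes "integrable lborel f"
  shows "integrable lborel (\<lambda>x. iexp (t * x) * complex_of_real (f x))"
proof (rule Bochner_Integration.integrable_bound[OF assms])
  have [measurable]: "f \<in> borel_measurable borel" using assms by auto
  show "(\<lambda>x. iexp (t * x) * complex_of_real (f x)) \<in> borel_measurable lborel" by measurable
qed (simp add: norm_mult)

text \<open>The kernel is even, so the transforms at t and -t agree; adding them cancels the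
  imaginary parts and leaves the cosine integral.\<close>

lemma phi_fejer:
  assumes "0 < L"
  shows "phi (fejer L) t = complex_of_real (max 0 (1 - \<bar>t\<bar> / L))"
proof -
  have even: "fejer L (- x) = fejer L x" for x by (simp add: fejer_def)
  have "phi (fejer L) t = (CLINT x|lborel. iexp (- t * x) * complex_of_real (fejer L x))"
    unfolding phi_def by (subst lborel_integral_real_affine[where c="-1" and t=0]) (simp_all add: even)
  then have "2 * phi (fejer L) t = (CLINT x|lborel. iexp (t * x) * complex_of_real (fejer L x))
      + (CLINT x|lborel. iexp (- t * x) * complex_of_real (fejer L x))"
    by (simp add: phi_def)
  also have "\<dots> = (CLINT x|lborel. iexp (t * x) * complex_of_real (fejer L x)
      + iexp (- t * x) * complex_of_real (fejer L x))"
    by (rule Bochner_Integration.integral_add[symmetric])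
       (intro integrable_iexp_mult integrable_fejer assms)+
  also have "\<dots> = (CLINT x|lborel. complex_of_real (2 * (cos (t * x) * fejer L x)))"
    by (intro Bochner_Integration.integral_cong refl)
       (simp add: complex_eq_iff Re_exp Im_exp algebra_simps)
  also have "\<dots> = complex_of_real (2 * max 0 (1 - \<bar>t\<bar> / L))"
    using has_bochner_integral_cos_fejer[OF assms, of t]
    by (subst integral_complex_of_real) (simp add: has_bochner_integral_iff)
  finally show ?thesis by simp
qed

section \<open>The law of the observations\<close>

lemma prob_space_density_lborel:
  "prob_density f \<Longrightarrow> prob_space (density lborel f)"
  by (rule prob_spaceI) (simp add: prob_density_def emeasure_density)

lemma prob_density_iff_has_bochner_integral:
  assumes "\<And>x. 0 \<le> f x"
  shows "prob_density f \<longleftrightarrow> has_bochner_integral lborel f 1"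
proof
  assume "prob_density f"
  with assms show "has_bochner_integral lborel f 1"
    by (intro has_bochner_integral_nn_integral) (auto simp: prob_density_def)
next
  assume f: "has_bochner_integral lborel f 1"
  then have [measurable]: "f \<in> borel_measurable borel" by auto
  from f have "(\<integral>\<^sup>+x. ennreal (f x) \<partial>lborel) = ennreal 1"
    using assms by (subst nn_integral_eq_integral) (auto simp: has_bochner_integral_iff)
  with assms show "prob_density f" by (simp add: prob_density_def)
qed

lemma prob_density_integrable: "prob_density f \<Longrightarrow> integrable lborel f"
  using prob_density_iff_has_bochner_integral[of f] by (auto simp: prob_density_def has_bochner_integral_iff)

lemma nn_integral_A_law:
  assumes "0 \<le> p" "p \<le> 1" and [measurable]: "h \<in> borel_measurable borel"
  shows "(\<integral>\<^sup>+a. h a \<partial>A_law p) = ennreal (1 - p) * h 1 + ennreal p * h 0"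
  using assms unfolding A_law_def
  by (subst nn_integral_distr) (auto simp: mult.commute)

text \<open>A = 0 has probability p and forces Y = 0 whatever V is, so the law of Y is p times the
  atom at 0 plus 1 - p times the law of V.\<close>

lemma nn_integral_X_law:
  assumes f: "prob_density f" and p: "0 \<le> p" "p \<le> 1"
    and N: "prob_space N" "sets N = sets borel"
    and [measurable]: "h \<in> borel_measurable borel"
  shows "(\<integral>\<^sup>+x. h x \<partial>X_law N p f) = ennreal p * (\<integral>\<^sup>+z. h z \<partial>N)
    + ennreal (1 - p) * (\<integral>\<^sup>+v. ennreal (f v) * (\<integral>\<^sup>+z. h (v + z) \<partial>N) \<partial>lborel)"
proof -
  note [measurable_cong] = N(2)
  have [measurable]: "f \<in> borel_measurable borel" using f by (simp add: prob_density_def)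
  interpret N: prob_space N by fact
  interpret V: prob_space "density lborel f" using f by (rule prob_space_density_lborel)
  interpret A: prob_space "A_law p" unfolding A_law_def
    by (rule prob_space.prob_space_distr) (auto intro: prob_space_measure_pmf)
  interpret AV: pair_prob_space "A_law p" "density lborel f" ..
  have [measurable_cong]: "sets (A_law p) = sets borel" by (simp add: A_law_def)
  interpret Y: prob_space "Y_law p f" unfolding Y_law_def
    by (rule AV.prob_space_distr) measurable
  define k where "k y = (\<integral>\<^sup>+z. h (y + z) \<partial>N)" for y
  have [measurable]: "k \<in> borel_measurable borel" unfolding k_def by measurable
  have "(\<integral>\<^sup>+x. h x \<partial>X_law N p f) = (\<integral>\<^sup>+y. k y \<partial>Y_law p f)"
    unfolding X_law_def k_def
    by (rule nn_integral_convolution) (auto simp: N Y_law_def intro: Y.finite_measure_axioms[unfolded Y_law_def] N.finite_measure_axioms)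
  also have "\<dots> = (\<integral>\<^sup>+x. k (fst x * snd x) \<partial>(A_law p \<Otimes>\<^sub>M density lborel f))"
    unfolding Y_law_def by (subst nn_integral_distr) (auto simp: case_prod_beta)
  also have "\<dots> = (\<integral>\<^sup>+a. \<integral>\<^sup>+v. k (a * v) \<partial>density lborel f \<partial>A_law p)"
    by (subst V.nn_integral_fst[symmetric]) auto
  also have "\<dots> = ennreal (1 - p) * (\<integral>\<^sup>+v. k (1 * v) \<partial>density lborel f)
      + ennreal p * (\<integral>\<^sup>+v. k (0 * v) \<partial>density lborel f)"
    by (intro nn_integral_A_law p) measurable
  also have "(\<integral>\<^sup>+v. k (0 * v) \<partial>density lborel f) = k 0"
    using V.emeasure_space_1 by simp
  also have "(\<integral>\<^sup>+v. k (1 * v) \<partial>density lborel f) = (\<integral>\<^sup>+v. ennreal (f v) * k v \<partial>lborel)"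
    by (simp add: nn_integral_density)
  finally show ?thesis by (simp add: k_def add.commute)
qed

lemma prob_space_X_law:
  assumes "prob_density f" "0 \<le> p" "p \<le> 1" "prob_space N" "sets N = sets borel"
  shows "prob_space (X_law N p f)"
proof (rule prob_spaceI)
  interpret N: prob_space N by fact
  have "emeasure (X_law N p f) (space (X_law N p f)) = (\<integral>\<^sup>+x. 1 \<partial>X_law N p f)" by simp
  also have "\<dots> = ennreal p + ennreal (1 - p)"
    using assms N.emeasure_space_1 by (subst nn_integral_X_law) (auto simp: prob_density_def)
  also have "\<dots> = 1" using assms by (simp add: ennreal_plus[symmetric] del: ennreal_plus)
  finally show "emeasure (X_law N p f) (space (X_law N p f)) = 1" .
qed

section \<open>Smoothed density of an observation and its Fourier representation\<close>

definition X_density :: "real \<Rightarrow> (real \<Rightarrow> real) \<Rightarrow> real \<Rightarrow> real" where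
  "X_density p f x = p * std_normal_density x
     + (1 - p) * (\<integral>v. f v * std_normal_density (x - v) \<partial>lborel)"

lemma std_normal_density_le_1: "std_normal_density x \<le> 1"
proof -
  have "1 \<le> sqrt (2 * pi)" using pi_ge_two by (subst real_sqrt_ge_1_iff) simp
  moreover have "exp (- x\<^sup>2 / 2) \<le> 1" by simp
  ultimately have "exp (- x\<^sup>2 / 2) \<le> sqrt (2 * pi)" by linarith
  then show ?thesis unfolding std_normal_density_def
    by (simp add: divide_le_eq)
qed

lemma integrable_mult_std_normal_density:
  assumes "integrable lborel f"
  shows "integrable lborel (\<lambda>v. f v * std_normal_density (x - v))"
proof (rule Bochner_Integration.integrable_bound[OF assms])
  have [measurable]: "f \<in> borel_measurable borel" using assms by auto
  show "(\<lambda>v. f v * std_normal_density (x - v)) \<in> borel_measurable lborel" by measurable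
  show "AE v in lborel. norm (f v * std_normal_density (x - v)) \<le> norm (f v)"
    using std_normal_density_le_1 by (intro AE_I2) (simp add: abs_mult mult_left_le)
qed

lemma X_density_nonneg:
  assumes "prob_density f" "0 \<le> p" "p \<le> 1"
  shows "0 \<le> X_density p f x"
  unfolding X_density_def using assms
  by (intro add_nonneg_nonneg mult_nonneg_nonneg Bochner_Integration.integral_nonneg)
     (auto simp: prob_density_def)

lemma borel_measurable_X_density:
  assumes "prob_density f"
  shows "X_density p f \<in> borel_measurable borel"
proof -
  have [measurable]: "f \<in> borel_measurable borel" using assms by (simp add: prob_density_def)
  show ?thesis unfolding X_density_def[abs_def] by measurable
qed

text \<open>The mixture formula is tested on indicators. For each v a translation turns the noise
  into the normal density at x - v, and Tonelli exchanges the integrals over v and x.\<close>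

lemma X_law_eq_density:
  assumes f: "prob_density f" and p: "0 \<le> p" "p \<le> 1"
  shows "X_law std_normal_distribution p f = density lborel (\<lambda>x. ennreal (X_density p f x))"
proof (rule measure_eqI)
  show "sets (X_law std_normal_distribution p f) = sets (density lborel (\<lambda>x. ennreal (X_density p f x)))"
    by (simp add: X_law_def)
next
  let ?\<phi> = "\<lambda>x. ennreal (std_normal_density x)"
  fix A assume "A \<in> sets (X_law std_normal_distribution p f)"
  then have A[measurable]: "A \<in> sets borel" by (simp add: X_law_def)
  have fm[measurable]: "f \<in> borel_measurable borel" and f0: "\<And>x. 0 \<le> f x"
    using f by (auto simp: prob_density_def)
  have [measurable]: "X_density p f \<in> borel_measurable borel" by (rule borel_measurable_X_density[OF f])
  have conv: "ennreal (\<integral>v. f v * std_normal_density (x - v) \<partial>lborel) = (\<integral>\<^sup>+v. ennreal (f v) * ?\<phi> (x - v) \<partial>lborel)" for x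
    using integrable_mult_std_normal_density[OF prob_density_integrable[OF f], of x] f0
    by (subst nn_integral_eq_integral[symmetric]) (auto simp: ennreal_mult)
  have shift: "(\<integral>\<^sup>+z. ?\<phi> z * indicator A (v + z) \<partial>lborel) = (\<integral>\<^sup>+x. ?\<phi> (x - v) * indicator A x \<partial>lborel)" for v
    by (subst (2) nn_integral_real_affine[where c=1 and t=v]) auto
  have "emeasure (X_law std_normal_distribution p f) A
    = (\<integral>\<^sup>+x. indicator A x \<partial>X_law std_normal_distribution p f)"
    using A by (subst nn_integral_indicator) (auto simp: X_law_def)
  also have "\<dots> = ennreal p * (\<integral>\<^sup>+z. ?\<phi> z * indicator A z \<partial>lborel)
    + ennreal (1 - p) * (\<integral>\<^sup>+v. ennreal (f v) * (\<integral>\<^sup>+z. ?\<phi> z * indicator A (v + z) \<partial>lborel) \<partial>lborel)"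
    by (subst nn_integral_X_law[OF f p])
       (auto intro: prob_space_normal_density simp: nn_integral_density simp del: nn_integral_indicator)
  also have "(\<integral>\<^sup>+v. ennreal (f v) * (\<integral>\<^sup>+z. ?\<phi> z * indicator A (v + z) \<partial>lborel) \<partial>lborel)
    = (\<integral>\<^sup>+v. \<integral>\<^sup>+x. ennreal (f v) * ?\<phi> (x - v) * indicator A x \<partial>lborel \<partial>lborel)"
    unfolding shift by (subst nn_integral_cmult[symmetric]) (auto simp: mult.assoc)
  also have "\<dots> = (\<integral>\<^sup>+x. \<integral>\<^sup>+v. ennreal (f v) * ?\<phi> (x - v) * indicator A x \<partial>lborel \<partial>lborel)"
    by (rule lborel_pair.Fubini') measurable
  also have "\<dots> = (\<integral>\<^sup>+x. ennreal (\<integral>v. f v * std_normal_density (x - v) \<partial>lborel) * indicator A x \<partial>lborel)"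
    unfolding conv by (subst nn_integral_multc) auto
  also have "ennreal p * (\<integral>\<^sup>+z. ?\<phi> z * indicator A z \<partial>lborel) + ennreal (1 - p) * \<dots>
    = (\<integral>\<^sup>+x. ennreal (X_density p f x) * indicator A x \<partial>lborel)"
    using p f0
    by (subst (1 2) nn_integral_cmult[symmetric], simp, simp, simp)
       (subst nn_integral_add[symmetric], auto intro!: nn_integral_cong simp: X_density_def ennreal_plus ennreal_mult
          Bochner_Integration.integral_nonneg split: split_indicator)
  finally show "emeasure (X_law std_normal_distribution p f) A
      = emeasure (density lborel (\<lambda>x. ennreal (X_density p f x))) A"
    by (simp add: emeasure_density)
qed

text \<open>The Gaussian is its own Fourier transform: up to 1/sqrt(2 pi), the normal density at x -
  v is the characteristic function of the normal law there. Fubini lets v be integrated first, and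
  the factor exp(-ivz) produces \<open>phi f (- z)\<close>.\<close>

lemma gaussian_convolution_eq_fourier:
  assumes f: "integrable lborel f"
  shows "complex_of_real (\<integral>v. f v * std_normal_density (x - v) \<partial>lborel)
    = (CLINT z|std_normal_distribution. iexp (x * z) * phi f (- z)) / complex_of_real (sqrt (2 * pi))"
proof -
  have [measurable]: "f \<in> borel_measurable borel" using f by auto
  interpret N: prob_space std_normal_distribution by (rule prob_space_normal_density) simp
  interpret P: pair_sigma_finite lborel std_normal_distribution ..
  let ?g = "\<lambda>v z. complex_of_real (f v) * iexp ((x - v) * z)"
  have bound: "integrable std_normal_distribution (\<lambda>z. ?g v z)" for v
    by (intro integrable_mult_right N.integrable_const_bound[where B=1]) auto
  have int: "integrable (lborel \<Otimes>\<^sub>M std_normal_distribution) (case_prod ?g)"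
  proof (rule P.Fubini_integrable)
    show "integrable lborel (\<lambda>v. \<integral>z. norm (case_prod ?g (v, z)) \<partial>std_normal_distribution)"
      using f by (simp add: norm_mult N.prob_space[unfolded space_density space_lborel])
  qed (use bound in auto)
  have "complex_of_real (\<integral>v. f v * std_normal_density (x - v) \<partial>lborel)
      = (CLINT v|lborel. complex_of_real (f v * std_normal_density (x - v)))"
    by (rule integral_complex_of_real[symmetric])
  also have "\<dots> = (CLINT v|lborel. (CLINT z|std_normal_distribution. ?g v z) / complex_of_real (sqrt (2 * pi)))"
  proof (intro Bochner_Integration.integral_cong refl)
    fix v
    have "(CLINT z|std_normal_distribution. iexp ((x - v) * z)) = complex_of_real (exp (- (x - v)\<^sup>2 / 2))"
      using fun_cong[OF char_std_normal_distribution, of "x - v"] by (simp only: char_def)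
    then show "complex_of_real (f v * std_normal_density (x - v))
      = (CLINT z|std_normal_distribution. ?g v z) / complex_of_real (sqrt (2 * pi))"
      by (simp add: std_normal_density_def)
  qed
  also have "\<dots> = (CLINT v|lborel. CLINT z|std_normal_distribution. ?g v z) / complex_of_real (sqrt (2 * pi))"
    by simp
  also have "(CLINT v|lborel. CLINT z|std_normal_distribution. ?g v z)
      = (CLINT z|std_normal_distribution. CLINT v|lborel. ?g v z)"
    by (rule P.Fubini_integral[OF int, symmetric])
  also have "\<dots> = (CLINT z|std_normal_distribution. iexp (x * z) * phi f (- z))"
    unfolding phi_def
    by (intro Bochner_Integration.integral_cong refl, subst integral_mult_right_zero[symmetric],
        intro Bochner_Integration.integral_cong refl)
       (simp add: exp_add[symmetric] algebra_simps exp_diff exp_minus divide_inverse)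
  finally show ?thesis .
qed

section \<open>Two-point risk bound\<close>

text \<open>Factors are exchanged one at a time: the induction hypothesis replaces the product over
  \<open>I\<close> while the inner integral still uses \<open>M i\<close>, then \<open>M i\<close>
  gives way to \<open>N i\<close>. This lets a product of minorants be compared with a product of
  laws.\<close>

lemma nn_integral_PiM_mono:
  assumes M: "product_sigma_finite M" and N: "product_sigma_finite N"
    and sets: "\<And>i. sets (M i) = sets (N i)"
    and le: "\<And>i. M i \<le> N i"
    and "finite I" and "h \<in> borel_measurable (PiM I M)"
  shows "(\<integral>\<^sup>+x. h x \<partial>PiM I M) \<le> (\<integral>\<^sup>+x. h x \<partial>PiM I N)"
  using assms(5,6)
proof (induction I arbitrary: h rule: finite_induct)
  case empty
  then show ?case by (simp add: PiM_empty)
next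
  case (insert i I)
  interpret M: product_sigma_finite M by fact
  interpret N: product_sigma_finite N by fact
  note [measurable_cong] = sets sets_PiM_cong[OF refl sets]
  have Mi [measurable]: "h \<in> borel_measurable (PiM (insert i I) M)" by fact
  have Ni [measurable]: "h \<in> borel_measurable (PiM (insert i I) N)"
    using Mi by (simp cong: measurable_cong_sets add: sets_PiM_cong[OF refl sets])
  have inner [measurable]: "(\<lambda>x. \<integral>\<^sup>+y. h (x(i := y)) \<partial>M i) \<in> borel_measurable (PiM I M)"
    by measurable
  have "(\<integral>\<^sup>+x. h x \<partial>PiM (insert i I) M) = (\<integral>\<^sup>+x. \<integral>\<^sup>+y. h (x(i := y)) \<partial>M i \<partial>PiM I M)"
    using insert by (intro M.product_nn_integral_insert) auto
  also have "\<dots> \<le> (\<integral>\<^sup>+x. \<integral>\<^sup>+y. h (x(i := y)) \<partial>M i \<partial>PiM I N)"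
    by (rule insert.IH) measurable
  also have "\<dots> \<le> (\<integral>\<^sup>+x. \<integral>\<^sup>+y. h (x(i := y)) \<partial>N i \<partial>PiM I N)"
    by (intro nn_integral_mono nn_integral_mono_measure sets le)
  also have "\<dots> = (\<integral>\<^sup>+x. h x \<partial>PiM (insert i I) N)"
    using insert by (intro N.product_nn_integral_insert[symmetric]) auto
  finally show ?case .
qed

text \<open>The pointwise minimum of two densities is a common minorant whose product keeps the
  \<open>n\<close>-th power of its mass; on it both quadratic losses are charged simultaneously.\<close>

lemma two_point_risk_bound:
  fixes T :: "('i \<Rightarrow> real) \<Rightarrow> real" and g0 g1 :: "real \<Rightarrow> ennreal"
  assumes [measurable]: "g0 \<in> borel_measurable borel" "g1 \<in> borel_measurable borel"
    and g0: "prob_space (density lborel g0)" and g1: "prob_space (density lborel g1)"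
    and "finite I" and T: "T \<in> borel_measurable (PiM I (\<lambda>_. borel))"
  shows "ennreal ((p0 - p1)\<^sup>2 / 2) * (\<integral>\<^sup>+x. min (g0 x) (g1 x) \<partial>lborel) ^ card I
    \<le> (\<integral>\<^sup>+x. ennreal ((T x - p0)\<^sup>2) \<partial>PiM I (\<lambda>_. density lborel g0))
      + (\<integral>\<^sup>+x. ennreal ((T x - p1)\<^sup>2) \<partial>PiM I (\<lambda>_. density lborel g1))"
proof -
  let ?D = "density lborel (\<lambda>x. min (g0 x) (g1 x))"
  have le0: "?D \<le> density lborel g0" and le1: "?D \<le> density lborel g1"
    by (auto simp: le_measure emeasure_density intro!: nn_integral_mono mult_right_mono)
  interpret g0: prob_space "density lborel g0" by fact
  interpret g1: prob_space "density lborel g1" by fact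
  \<comment> \<open>The minorant has mass at most 1 and in general less, so it is a finite measure
    rather than a probability.\<close>
  interpret D: finite_measure ?D
  proof
    have "emeasure ?D (space ?D) \<le> emeasure (density lborel g0) UNIV"
      using le0 by (simp add: le_measure)
    also have "\<dots> = 1" using g0.emeasure_space_1 by simp
    finally show "emeasure ?D (space ?D) \<noteq> \<infinity>" by (auto simp: top_unique)
  qed
  have G0: "product_sigma_finite (\<lambda>_::'i. density lborel g0)" and G1: "product_sigma_finite (\<lambda>_::'i. density lborel g1)"
    and D: "product_sigma_finite (\<lambda>_::'i. ?D)"
    by (auto simp: product_sigma_finite_def g0.sigma_finite_measure_axioms g1.sigma_finite_measure_axioms D.sigma_finite_measure_axioms)
  have setsD: "sets (PiM I (\<lambda>_. ?D)) = sets (PiM I (\<lambda>_. borel))"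
    by (intro sets_PiM_cong) auto
  have [measurable]: "T \<in> borel_measurable (PiM I (\<lambda>_. ?D))"
    using T by (simp cong: measurable_cong_sets add: setsD)
  have loss: "ennreal ((p0 - p1)\<^sup>2 / 2) \<le> ennreal ((T x - p0)\<^sup>2) + ennreal ((T x - p1)\<^sup>2)" for x
  proof -
    \<comment> \<open>The two sides of the loss inequality differ by exactly half of this
      square.\<close>
    have "0 \<le> (2 * T x - p0 - p1)\<^sup>2" by simp
    then have "(p0 - p1)\<^sup>2 / 2 \<le> (T x - p0)\<^sup>2 + (T x - p1)\<^sup>2"
      by (simp add: power2_eq_square field_simps)
    then show ?thesis by (simp add: ennreal_plus[symmetric] ennreal_leI del: ennreal_plus)
  qed
  have "emeasure (PiM I (\<lambda>_. ?D)) (space (PiM I (\<lambda>_. ?D))) = (\<integral>\<^sup>+x. min (g0 x) (g1 x) \<partial>lborel) ^ card I"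
    using product_sigma_finite.emeasure_PiM[OF D \<open>finite I\<close>, of "\<lambda>_. UNIV"]
    by (simp add: space_PiM emeasure_density)
  then have "ennreal ((p0 - p1)\<^sup>2 / 2) * (\<integral>\<^sup>+x. min (g0 x) (g1 x) \<partial>lborel) ^ card I
    = (\<integral>\<^sup>+x. ennreal ((p0 - p1)\<^sup>2 / 2) \<partial>PiM I (\<lambda>_. ?D))" by simp
  also have "\<dots> \<le> (\<integral>\<^sup>+x. ennreal ((T x - p0)\<^sup>2) + ennreal ((T x - p1)\<^sup>2) \<partial>PiM I (\<lambda>_. ?D))"
    by (intro nn_integral_mono loss)
  also have "\<dots> = (\<integral>\<^sup>+x. ennreal ((T x - p0)\<^sup>2) \<partial>PiM I (\<lambda>_. ?D)) + (\<integral>\<^sup>+x. ennreal ((T x - p1)\<^sup>2) \<partial>PiM I (\<lambda>_. ?D))"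
    by (rule nn_integral_add) measurable
  also have "\<dots> \<le> (\<integral>\<^sup>+x. ennreal ((T x - p0)\<^sup>2) \<partial>PiM I (\<lambda>_. density lborel g0))
      + (\<integral>\<^sup>+x. ennreal ((T x - p1)\<^sup>2) \<partial>PiM I (\<lambda>_. density lborel g1))"
    by (intro add_mono nn_integral_PiM_mono D G0 G1 le0 le1 \<open>finite I\<close>) auto
  finally show ?thesis .
qed

section \<open>Fejer mixtures\<close>

text \<open>The normalisation is chosen for p = 1/2 - \<eta>: then 1 - p cancels the denominator,
  and the continuous part of Y is exactly F_m/2 + \<eta> F_L.\<close>

definition spiked_density :: "real \<Rightarrow> real \<Rightarrow> real \<Rightarrow> real \<Rightarrow> real" where
  "spiked_density m \<eta> L x = (fejer m x / 2 + \<eta> * fejer L x) / (1/2 + \<eta>)"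

lemma phi_spiked_density:
  assumes "0 < m" "0 < L"
  shows "phi (spiked_density m \<eta> L) t
    = complex_of_real ((max 0 (1 - \<bar>t\<bar> / m) / 2 + \<eta> * max 0 (1 - \<bar>t\<bar> / L)) / (1/2 + \<eta>))"
proof -
  have "phi (spiked_density m \<eta> L) t = (CLINT x|lborel.
      (iexp (t * x) * complex_of_real (fejer m x) / 2
        + complex_of_real \<eta> * (iexp (t * x) * complex_of_real (fejer L x))) / complex_of_real (1/2 + \<eta>))"
    unfolding phi_def spiked_density_def
    by (intro Bochner_Integration.integral_cong refl) (simp add: algebra_simps add_divide_distrib)
  also have "\<dots> = (phi (fejer m) t / 2 + complex_of_real \<eta> * phi (fejer L) t) / complex_of_real (1/2 + \<eta>)"
    unfolding phi_def integral_divide_zero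
    using integrable_iexp_mult[OF integrable_fejer[OF assms(1)], of t]
      integrable_iexp_mult[OF integrable_fejer[OF assms(2)], of t]
    by (subst Bochner_Integration.integral_add) (auto simp del: of_real_mult)
  finally show ?thesis using assms by (simp add: phi_fejer)
qed

lemma prob_density_spiked:
  assumes "0 < m" "0 < L" "0 \<le> \<eta>"
  shows "prob_density (spiked_density m \<eta> L)"
proof -
  have "has_bochner_integral lborel (\<lambda>x. (fejer m x / 2 + \<eta> * fejer L x) / (1/2 + \<eta>))
      ((1 / 2 + \<eta> * 1) / (1/2 + \<eta>))"
    by (intro has_bochner_integral_divide_zero has_bochner_integral_add has_bochner_integral_mult_right
        has_bochner_integral_fejer assms)
  with assms show ?thesis
    by (subst prob_density_iff_has_bochner_integral)
       (auto simp: spiked_density_def[abs_def] fejer_nonneg)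
qed

text \<open>The constant does not depend on L, so the tails of X are controlled uniformly even
  though L will grow with n.\<close>

lemma spiked_density_le:
  assumes "0 < m" "1 \<le> L" "0 \<le> \<eta>" "\<eta> \<le> 1/2"
  shows "spiked_density m \<eta> L x \<le> (2 / (fejer_mass * m) + 2 / fejer_mass) / x\<^sup>2"
proof -
  have nn: "0 \<le> fejer m x" "0 \<le> fejer L x" using assms by (auto intro: fejer_nonneg)
  have "spiked_density m \<eta> L x \<le> fejer m x + fejer L x"
  proof -
    have "\<eta> * fejer L x \<le> 1/2 * fejer L x"
      using assms nn by (intro mult_right_mono)
    moreover have "0 \<le> \<eta> * fejer m x" "0 \<le> \<eta> * fejer L x"
      using assms nn by auto
    ultimately
    have "fejer m x / 2 + \<eta> * fejer L x \<le> (fejer m x + fejer L x) * (1/2 + \<eta>)"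
      by (simp add: algebra_simps)
    then show ?thesis using assms by (simp add: spiked_density_def divide_le_eq)
  qed
  also have "fejer m x \<le> 2 / (fejer_mass * m) / x\<^sup>2" using assms by (intro fejer_le)
  also have "fejer L x \<le> 2 / fejer_mass / x\<^sup>2"
  proof -
    have "fejer L x \<le> 2 / (fejer_mass * L) / x\<^sup>2" using assms by (intro fejer_le) simp
    also have "\<dots> \<le> 2 / fejer_mass / x\<^sup>2"
      using assms fejer_mass_pos by (intro divide_right_mono divide_left_mono) auto
    finally show ?thesis .
  qed
  finally show ?thesis by (simp add: add_divide_distrib)
qed

text \<open>The triangle is at most 1 and supported on [-L, L], where the weight is largest at the
  endpoints. Integrated, this crude bound has order L^(2\<alpha>+1) for large L.\<close>

lemma triangle_square_weight_le:
  fixes L \<alpha> t :: real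
  assumes "0 < L" "0 \<le> \<alpha>"
  shows "(max 0 (1 - \<bar>t\<bar> / L))\<^sup>2 * (1 + \<bar>t\<bar> powr (2 * \<alpha>)) \<le> (1 + L powr (2 * \<alpha>)) * indicator {-L..L} t"
proof (cases "\<bar>t\<bar> \<le> L")
  case True
  have "(max 0 (1 - \<bar>t\<bar> / L))\<^sup>2 * (1 + \<bar>t\<bar> powr (2 * \<alpha>)) \<le> 1 * (1 + L powr (2 * \<alpha>))"
  proof (intro mult_mono add_left_mono powr_mono2)
    show "(max 0 (1 - \<bar>t\<bar> / L))\<^sup>2 \<le> 1"
      using assms by (intro power_le_one) auto
  qed (use assms True in auto)
  with True show ?thesis by (simp add: abs_le_iff indicator_def)
next
  case False
  then have "max 0 (1 - \<bar>t\<bar> / L) = 0" using assms by (simp add: field_simps)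
  with False show ?thesis by (simp add: indicator_def abs_le_iff)
qed

text \<open>The denominator is at least 1/2, so the transform is at most A + 2 \<eta> B for the two
  triangles A and B. The inequality (a+b)^2 \<le> 2a^2 + 2b^2 separates them, and the interval
  lengths 2m and 2L yield the constants 4 and 16.\<close>

lemma spiked_density_Sobolev:
  assumes "0 < m" "0 < L" "0 \<le> \<eta>" "0 < \<alpha>"
    and K: "4 * m * (1 + m powr (2 * \<alpha>)) + 16 * \<eta>\<^sup>2 * L * (1 + L powr (2 * \<alpha>)) \<le> K"
  shows "spiked_density m \<eta> L \<in> Sobolev_densities \<alpha> K"
proof -
  let ?w = "\<lambda>t. 1 + \<bar>t\<bar> powr (2 * \<alpha>)"
  have pt: "(cmod (phi (spiked_density m \<eta> L) t))\<^sup>2 * ?w t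
    \<le> 2 * (1 + m powr (2 * \<alpha>)) * indicator {-m..m} t
      + 8 * \<eta>\<^sup>2 * (1 + L powr (2 * \<alpha>)) * indicator {-L..L} t" for t
  proof -
    define A where "A = max 0 (1 - \<bar>t\<bar> / m)"
    define B where "B = max 0 (1 - \<bar>t\<bar> / L)"
    have AB: "0 \<le> A" "0 \<le> B" by (auto simp: A_def B_def)
    have "(A / 2 + \<eta> * B) / (1/2 + \<eta>) \<le> (A / 2 + \<eta> * B) / (1/2)"
      using assms AB by (intro divide_left_mono) auto
    then have "cmod (phi (spiked_density m \<eta> L) t) \<le> A + 2 * \<eta> * B"
      unfolding phi_spiked_density[OF assms(1,2)] A_def[symmetric] B_def[symmetric] norm_of_real
      using assms AB by (simp add: abs_of_nonneg)
    then have "(cmod (phi (spiked_density m \<eta> L) t))\<^sup>2 \<le> (A + 2 * \<eta> * B)\<^sup>2"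
      by (intro power_mono) auto
    also have "\<dots> \<le> 2 * A\<^sup>2 + 8 * \<eta>\<^sup>2 * B\<^sup>2"
      using zero_le_power2[of "A - 2 * \<eta> * B"] by (simp add: power2_eq_square algebra_simps)
    finally have "(cmod (phi (spiked_density m \<eta> L) t))\<^sup>2 * ?w t \<le> (2 * A\<^sup>2 + 8 * \<eta>\<^sup>2 * B\<^sup>2) * ?w t"
      by (intro mult_right_mono) auto
    also have "\<dots> = 2 * (A\<^sup>2 * ?w t) + 8 * \<eta>\<^sup>2 * (B\<^sup>2 * ?w t)" by (simp add: algebra_simps)
    also have "\<dots> \<le> 2 * ((1 + m powr (2 * \<alpha>)) * indicator {-m..m} t)
        + 8 * \<eta>\<^sup>2 * ((1 + L powr (2 * \<alpha>)) * indicator {-L..L} t)"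
      unfolding A_def B_def using assms by (intro add_mono mult_left_mono triangle_square_weight_le) auto
    finally show ?thesis by (simp only: mult.assoc)
  qed
  have "(\<integral>\<^sup>+t. ennreal ((cmod (phi (spiked_density m \<eta> L) t))\<^sup>2 * ?w t) \<partial>lborel)
    \<le> (\<integral>\<^sup>+t. ennreal (2 * (1 + m powr (2 * \<alpha>))) * indicator {-m..m} t
      + ennreal (8 * \<eta>\<^sup>2 * (1 + L powr (2 * \<alpha>))) * indicator {-L..L} t \<partial>lborel)"
  proof (intro nn_integral_mono)
    fix t
    have "ennreal ((cmod (phi (spiked_density m \<eta> L) t))\<^sup>2 * ?w t)
      \<le> ennreal (2 * (1 + m powr (2 * \<alpha>)) * indicator {-m..m} t
      + 8 * \<eta>\<^sup>2 * (1 + L powr (2 * \<alpha>)) * indicator {-L..L} t)" using pt by (rule ennreal_leI)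
    then show "ennreal ((cmod (phi (spiked_density m \<eta> L) t))\<^sup>2 * ?w t)
      \<le> ennreal (2 * (1 + m powr (2 * \<alpha>))) * indicator {-m..m} t
      + ennreal (8 * \<eta>\<^sup>2 * (1 + L powr (2 * \<alpha>))) * indicator {-L..L} t"
      by (subst (asm) ennreal_plus) (auto simp: ennreal_mult ennreal_indicator)
  qed
  also have "\<dots> = ennreal (2 * (1 + m powr (2 * \<alpha>))) * ennreal (2 * m)
      + ennreal (8 * \<eta>\<^sup>2 * (1 + L powr (2 * \<alpha>))) * ennreal (2 * L)"
    using assms by (subst nn_integral_add) (auto simp: nn_integral_cmult)
  also have "\<dots> = ennreal (4 * m * (1 + m powr (2 * \<alpha>)) + 16 * \<eta>\<^sup>2 * L * (1 + L powr (2 * \<alpha>)))"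
    using assms by (simp add: ennreal_mult[symmetric] ennreal_plus[symmetric] add_nonneg_nonneg algebra_simps del: ennreal_plus)
  also have "\<dots> \<le> ennreal K" using K by (rule ennreal_leI)
  finally show ?thesis using prob_density_spiked[OF assms(1-3)] by (simp add: Sobolev_densities_def)
qed

section \<open>Closeness of the two smoothed hypotheses\<close>

lemma gaussian_tail:
  assumes "0 \<le> M"
  shows "(\<integral>\<^sup>+z. indicator {z. M \<le> \<bar>z\<bar>} z \<partial>std_normal_distribution) \<le> ennreal (sqrt 2 * exp (- M\<^sup>2 / 4))"
proof -
  \<comment> \<open>Half of the exponent pays for exp(-M^2/4); the other half is, up to sqrt 2, the
    normal density of variance 2, which integrates to 1.\<close>
  have pt: "std_normal_density z * indicator {z. M \<le> \<bar>z\<bar>} z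
      \<le> sqrt 2 * exp (- M\<^sup>2 / 4) * normal_density 0 (sqrt 2) z" for z
  proof (cases "M \<le> \<bar>z\<bar>")
    case True
    then have "M\<^sup>2 \<le> z\<^sup>2" using assms by (simp add: abs_le_square_iff[symmetric])
    then have "exp (- z\<^sup>2 / 2) \<le> exp (- M\<^sup>2 / 4) * exp (- z\<^sup>2 / 4)"
      by (simp add: exp_add[symmetric])
    then have "1 / sqrt (2 * pi) * exp (- z\<^sup>2 / 2) \<le> 1 / sqrt (2 * pi) * (exp (- M\<^sup>2 / 4) * exp (- z\<^sup>2 / 4))"
      by (intro mult_left_mono) auto
    also have "\<dots> = sqrt 2 * exp (- M\<^sup>2 / 4) * normal_density 0 (sqrt 2) z"
      by (simp add: normal_density_def real_sqrt_mult field_simps)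
    finally show ?thesis using True by (simp add: std_normal_density_def)
  qed simp
  have "(\<integral>\<^sup>+z. indicator {z. M \<le> \<bar>z\<bar>} z \<partial>std_normal_distribution)
    = (\<integral>\<^sup>+z. ennreal (std_normal_density z * indicator {z. M \<le> \<bar>z\<bar>} z) \<partial>lborel)"
    by (subst nn_integral_density) (auto simp: ennreal_mult ennreal_indicator intro!: nn_integral_cong)
  also have "\<dots> \<le> (\<integral>\<^sup>+z. ennreal (sqrt 2 * exp (- M\<^sup>2 / 4) * normal_density 0 (sqrt 2) z) \<partial>lborel)"
    by (intro nn_integral_mono ennreal_leI pt)
  also have "\<dots> = ennreal (sqrt 2 * exp (- M\<^sup>2 / 4))"
    by (subst nn_integral_eq_integral) auto
  finally show ?thesis .
qed

text \<open>For |z| \<le> M the terms cancel exactly; between M and 2M the sum is |z|/M - 1, and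
  beyond 2M it is 1.\<close>

lemma triangle_combination_bound:
  fixes M z :: real
  assumes "0 < M"
  shows "\<bar>1 + max 0 (1 - \<bar>z\<bar> / M) - 2 * max 0 (1 - \<bar>z\<bar> / (2 * M))\<bar> \<le> indicator {z. M \<le> \<bar>z\<bar>} z"
  using assms by (auto simp: max_def indicator_def field_simps abs_le_iff)

text \<open>On the Fourier side the combination is a Gaussian average of \<open>iexp (x * z)\<close>
  times the multiplier \<open>?u z\<close>. The exponential has modulus 1, so the bound is uniform
  in x, and the multiplier vanishes for |z| < M, leaving only a Gaussian tail.\<close>

lemma gaussian_spike_difference_le:
  assumes M: "0 < M"
  shows "\<bar>std_normal_density x + (\<integral>v. fejer M v * std_normal_density (x - v) \<partial>lborel)
     - 2 * (\<integral>v. fejer (2 * M) v * std_normal_density (x - v) \<partial>lborel)\<bar> \<le> sqrt 2 * exp (- M\<^sup>2 / 4)"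
proof -
  interpret N: prob_space std_normal_distribution by (rule prob_space_normal_density) simp
  let ?N = "std_normal_distribution" and ?c = "complex_of_real (sqrt (2 * pi))"
  let ?\<tau> = "\<lambda>L z. max 0 (1 - \<bar>z\<bar> / L)"
  let ?u = "\<lambda>z. 1 + ?\<tau> M z - 2 * ?\<tau> (2 * M) z"
  have tau: "\<bar>?\<tau> L z\<bar> \<le> 1" if "0 < L" for L z :: real using that by auto
  have int: "integrable ?N (\<lambda>z. iexp (x * z) * complex_of_real (?\<tau> L z))" if "0 < L" for L
    using tau[OF that]
    by (intro N.integrable_const_bound[where B=1] AE_I2) (auto simp: norm_mult simp del: of_real_mult)
  have int1: "integrable ?N (\<lambda>z. iexp (x * z))"
    by (intro N.integrable_const_bound[where B=1] AE_I2) (auto simp del: of_real_mult)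
  \<comment> \<open>The triangle is even, so the argument \<open>- z\<close> of the transform
    becomes \<open>z\<close>.\<close>
  have conv: "complex_of_real (\<integral>v. fejer L v * std_normal_density (x - v) \<partial>lborel)
      = (CLINT z|?N. iexp (x * z) * complex_of_real (?\<tau> L z)) / ?c" if "0 < L" for L
    using that by (subst gaussian_convolution_eq_fourier) (auto simp: integrable_fejer phi_fejer)
  \<comment> \<open>The smoothed atom at 0, whose transform is constantly 1; it accounts for the
    summand 1 of \<open>?u\<close>.\<close>
  have gauss: "complex_of_real (std_normal_density x) = (CLINT z|?N. iexp (x * z)) / ?c"
    using fun_cong[OF char_std_normal_distribution, of x]
    by (simp only: char_def std_normal_density_def) simp
  have "complex_of_real (std_normal_density x + (\<integral>v. fejer M v * std_normal_density (x - v) \<partial>lborel)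
     - 2 * (\<integral>v. fejer (2 * M) v * std_normal_density (x - v) \<partial>lborel))
    = ((CLINT z|?N. iexp (x * z)) + (CLINT z|?N. iexp (x * z) * complex_of_real (?\<tau> M z))
       - 2 * (CLINT z|?N. iexp (x * z) * complex_of_real (?\<tau> (2 * M) z))) / ?c"
    unfolding of_real_add of_real_diff of_real_mult[of 2] gauss conv[OF M] using conv[of "2 * M"] M
    by (simp add: add_divide_distrib diff_divide_distrib)
  also have "\<dots> = (CLINT z|?N. iexp (x * z) * complex_of_real (?u z)) / ?c"
  proof -
    have "(CLINT z|?N. iexp (x * z) * complex_of_real (?u z))
      = (CLINT z|?N. iexp (x * z) + iexp (x * z) * complex_of_real (?\<tau> M z)
         - 2 * (iexp (x * z) * complex_of_real (?\<tau> (2 * M) z)))"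
      by (intro Bochner_Integration.integral_cong refl) (simp only: of_real_add of_real_diff of_real_mult, simp add: algebra_simps)
    then show ?thesis
      using int1 int[OF M] int[of "2 * M"] M by (simp del: of_real_mult)
  qed
  finally have eq: "complex_of_real (std_normal_density x + (\<integral>v. fejer M v * std_normal_density (x - v) \<partial>lborel)
     - 2 * (\<integral>v. fejer (2 * M) v * std_normal_density (x - v) \<partial>lborel))
     = (CLINT z|?N. iexp (x * z) * complex_of_real (?u z)) / ?c" .
  have u: "\<bar>?u z\<bar> \<le> indicator {z. M \<le> \<bar>z\<bar>} z" for z
    by (rule triangle_combination_bound[OF M])
  have u1: "\<bar>?u z\<bar> \<le> 1" for z
    using u[of z] by (rule order_trans) (simp add: indicator_def)
  have intu: "integrable ?N (\<lambda>z. iexp (x * z) * complex_of_real (?u z))"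
  proof (rule N.integrable_const_bound[where B=1])
    show "AE z in ?N. norm (iexp (x * z) * complex_of_real (?u z)) \<le> 1"
      unfolding norm_mult norm_of_real norm_exp_i_times using u1 by simp
  qed measurable
  have "ennreal (norm (CLINT z|?N. iexp (x * z) * complex_of_real (?u z)))
      \<le> (\<integral>\<^sup>+z. ennreal (norm (iexp (x * z) * complex_of_real (?u z))) \<partial>?N)"
    by (rule integral_norm_bound_ennreal[OF intu])
  also have "\<dots> \<le> (\<integral>\<^sup>+z. indicator {z. M \<le> \<bar>z\<bar>} z \<partial>?N)"
    unfolding norm_mult norm_of_real norm_exp_i_times ennreal_indicator[symmetric]
    using u by (intro nn_integral_mono ennreal_leI) simp
  also have "\<dots> \<le> ennreal (sqrt 2 * exp (- M\<^sup>2 / 4))"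
    using M by (intro gaussian_tail) simp
  finally have "norm (CLINT z|?N. iexp (x * z) * complex_of_real (?u z)) \<le> sqrt 2 * exp (- M\<^sup>2 / 4)"
    by (subst (asm) ennreal_le_iff) auto
  moreover have "1 \<le> sqrt (2 * pi)" using pi_ge_two by (subst real_sqrt_ge_1_iff) simp
  then have "norm (CLINT z|?N. iexp (x * z) * complex_of_real (?u z)) / sqrt (2 * pi)
      \<le> norm (CLINT z|?N. iexp (x * z) * complex_of_real (?u z)) / 1"
    by (intro divide_left_mono) auto
  moreover have "\<bar>std_normal_density x + (\<integral>v. fejer M v * std_normal_density (x - v) \<partial>lborel)
     - 2 * (\<integral>v. fejer (2 * M) v * std_normal_density (x - v) \<partial>lborel)\<bar>
     = norm (CLINT z|?N. iexp (x * z) * complex_of_real (?u z)) / sqrt (2 * pi)"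
    using arg_cong[OF eq, of norm] unfolding norm_of_real norm_divide by simp
  ultimately show ?thesis by linarith
qed

section \<open>Tails and overlap\<close>

text \<open>The antiderivative -B/x of the majorant gives B/r on each half-line.\<close>

lemma inverse_square_tail:
  fixes f :: "real \<Rightarrow> real"
  assumes f: "\<And>x. f x \<le> B / x\<^sup>2" and "0 \<le> B" "0 < r"
  shows "(\<integral>\<^sup>+v. ennreal (f v) * indicator {v. r \<le> \<bar>v\<bar>} v \<partial>lborel) \<le> ennreal (2 * B / r)"
proof -
  let ?I = "\<integral>\<^sup>+v. ennreal (B / v\<^sup>2) * indicator {r..} v \<partial>lborel"
  have "?I = ennreal (0 - (- B / r))"
  proof (rule nn_integral_FTC_atLeast)
    show "((\<lambda>x. - B / x) \<longlongrightarrow> 0) at_top"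
      by (rule tendsto_divide_0[OF tendsto_const filterlim_at_top_imp_at_infinity[OF filterlim_ident]])
  qed (use assms in \<open>auto intro!: derivative_eq_intros simp: power2_eq_square\<close>)
  then have I: "?I = ennreal (B / r)" by simp
  have "(\<integral>\<^sup>+v. ennreal (f v) * indicator {v. r \<le> \<bar>v\<bar>} v \<partial>lborel)
    \<le> (\<integral>\<^sup>+v. ennreal (B / v\<^sup>2) * indicator {r..} v + ennreal (B / v\<^sup>2) * indicator {r..} (- v) \<partial>lborel)"
    using f assms(3) by (intro nn_integral_mono) (auto intro!: ennreal_leI split: split_indicator)
  also have "\<dots> = ?I + (\<integral>\<^sup>+v. ennreal (B / v\<^sup>2) * indicator {r..} (- v) \<partial>lborel)"
    by (rule nn_integral_add) auto
  also have "(\<integral>\<^sup>+v. ennreal (B / v\<^sup>2) * indicator {r..} (- v) \<partial>lborel) = ?I"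
    by (subst (2) nn_integral_real_affine[where c="-1" and t=0]) auto
  finally show ?thesis
    unfolding I using assms by (simp add: ennreal_plus[symmetric] del: ennreal_plus)
qed

text \<open>If |v + z| > R, then |v| or |z| is at least R/2. The first event has probability of
  order 1/R by the inverse-square bound, the second is a Gaussian tail.\<close>

lemma X_law_tail_le:
  assumes f: "prob_density f" and p: "0 \<le> p" "p \<le> 1"
    and fB: "\<And>x. f x \<le> B / x\<^sup>2" and B: "0 \<le> B" and R: "1 \<le> R"
  shows "emeasure (X_law std_normal_distribution p f) {x. R < \<bar>x\<bar>} \<le> ennreal ((4 * B + 24) / R)"
proof -
  let ?N = "std_normal_distribution"
  interpret N: prob_space ?N by (rule prob_space_normal_density) simp
  have [measurable]: "f \<in> borel_measurable borel" using f by (simp add: prob_density_def)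
  define \<gamma> where "\<gamma> = (\<integral>\<^sup>+z. indicator {z. R / 2 \<le> \<bar>z\<bar>} z \<partial>?N)"
  define \<beta> where "\<beta> = (\<integral>\<^sup>+v. ennreal (f v) * indicator {v. R / 2 \<le> \<bar>v\<bar>} v \<partial>lborel)"
  have g: "(\<integral>\<^sup>+z. indicator {x. R < \<bar>x\<bar>} z \<partial>?N) \<le> \<gamma>"
    unfolding \<gamma>_def using R by (intro nn_integral_mono) (auto split: split_indicator)
  have "(\<integral>\<^sup>+z. indicator {x. R < \<bar>x\<bar>} (v + z) \<partial>?N) \<le> indicator {v. R / 2 \<le> \<bar>v\<bar>} v + \<gamma>" for v
  proof -
    have "(\<integral>\<^sup>+z. indicator {x. R < \<bar>x\<bar>} (v + z) \<partial>?N)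
      \<le> (\<integral>\<^sup>+z. indicator {v. R / 2 \<le> \<bar>v\<bar>} v + indicator {z. R / 2 \<le> \<bar>z\<bar>} z \<partial>?N)"
      by (intro nn_integral_mono) (auto split: split_indicator)
    also have "\<dots> = indicator {v. R / 2 \<le> \<bar>v\<bar>} v + \<gamma>"
      unfolding \<gamma>_def using N.emeasure_space_1 by (subst nn_integral_add) auto
    finally show ?thesis .
  qed
  then have "(\<integral>\<^sup>+v. ennreal (f v) * (\<integral>\<^sup>+z. indicator {x. R < \<bar>x\<bar>} (v + z) \<partial>?N) \<partial>lborel)
    \<le> (\<integral>\<^sup>+v. ennreal (f v) * indicator {v. R / 2 \<le> \<bar>v\<bar>} v + ennreal (f v) * \<gamma> \<partial>lborel)"
    unfolding distrib_left[symmetric] by (intro nn_integral_mono mult_left_mono) auto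
  also have "\<dots> = \<beta> + \<gamma>"
    using f by (subst nn_integral_add) (auto simp: \<beta>_def nn_integral_multc prob_density_def)
  finally have v: "(\<integral>\<^sup>+v. ennreal (f v) * (\<integral>\<^sup>+z. indicator {x. R < \<bar>x\<bar>} (v + z) \<partial>?N) \<partial>lborel) \<le> \<beta> + \<gamma>" .
  have "\<beta> \<le> ennreal (2 * B / (R / 2))" unfolding \<beta>_def using R B by (intro inverse_square_tail fB) auto
  then have \<beta>: "\<beta> \<le> ennreal (4 * B / R)" by simp
  have "\<gamma> \<le> ennreal (sqrt 2 * exp (- (R / 2)\<^sup>2 / 4))"
    unfolding \<gamma>_def using R by (intro gaussian_tail) auto
  \<comment> \<open>The Gaussian tail is weakened to the rate 1/R of the other term, using 1 + u
    \<le> exp u at u = R^2/16 and R \<le> R^2. The constant is 16 times 3/2, with 3/2 an upper bound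
    of sqrt 2.\<close>
  also have "\<dots> \<le> ennreal (24 / R)"
  proof (rule ennreal_leI)
    have "R \<le> R\<^sup>2" using R by (simp add: power2_eq_square)
    moreover have "(R / 2)\<^sup>2 / 4 = R\<^sup>2 / 16" by (simp add: power_divide)
    ultimately have "R / 16 \<le> exp ((R / 2)\<^sup>2 / 4)"
      using exp_ge_add_one_self[of "(R / 2)\<^sup>2 / 4"] by linarith
    then have "exp (- (R / 2)\<^sup>2 / 4) \<le> 16 / R"
      using R by (simp add: exp_minus field_simps)
    moreover have "sqrt 2 \<le> 3 / 2" by (rule real_le_lsqrt) (auto simp: power2_eq_square)
    ultimately have "sqrt 2 * exp (- (R / 2)\<^sup>2 / 4) \<le> 3 / 2 * (16 / R)" by (intro mult_mono) auto
    then show "sqrt 2 * exp (- (R / 2)\<^sup>2 / 4) \<le> 24 / R" by simp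
  qed
  finally have \<gamma>: "\<gamma> \<le> ennreal (24 / R)" .
  have "emeasure (X_law ?N p f) {x. R < \<bar>x\<bar>} = (\<integral>\<^sup>+x. indicator {x. R < \<bar>x\<bar>} x \<partial>X_law ?N p f)"
    by (subst nn_integral_indicator) (auto simp: X_law_def)
  also have "\<dots> = ennreal p * (\<integral>\<^sup>+z. indicator {x. R < \<bar>x\<bar>} z \<partial>?N)
    + ennreal (1 - p) * (\<integral>\<^sup>+v. ennreal (f v) * (\<integral>\<^sup>+z. indicator {x. R < \<bar>x\<bar>} (v + z) \<partial>?N) \<partial>lborel)"
    by (rule nn_integral_X_law[OF f p N.prob_space_axioms]) auto
  \<comment> \<open>The atom only contributes \<open>\<gamma>\<close>; enlarging this to
    \<open>\<beta> + \<gamma>\<close> lets the weights p and 1 - p recombine to 1.\<close>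
  also have "\<dots> \<le> ennreal p * (\<beta> + \<gamma>) + ennreal (1 - p) * (\<beta> + \<gamma>)"
    using v g by (intro add_mono mult_left_mono) (auto intro: order_trans add_increasing)
  also have "\<dots> = \<beta> + \<gamma>"
    using p by (simp add: distrib_right[symmetric] ennreal_plus[symmetric] del: ennreal_plus)
  also have "\<dots> \<le> ennreal (4 * B / R) + ennreal (24 / R)" by (intro add_mono \<beta> \<gamma>)
  also have "\<dots> = ennreal ((4 * B + 24) / R)"
    using R B by (simp add: ennreal_plus[symmetric] add_divide_distrib del: ennreal_plus)
  finally show ?thesis .
qed

text \<open>Passing from \<open>g0\<close> to the minimum loses at most \<epsilon> per unit length
  on [-R, R], and outside at most the whole tail of \<open>g0\<close>.\<close>

lemma min_density_mass_ge:
  fixes g0 g1 :: "real \<Rightarrow> real"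
  assumes [measurable]: "g0 \<in> borel_measurable borel" "g1 \<in> borel_measurable borel"
    and nn: "\<And>x. 0 \<le> g0 x" "\<And>x. 0 \<le> g1 x"
    and one: "(\<integral>\<^sup>+x. ennreal (g0 x) \<partial>lborel) = 1"
    and eps: "\<And>x. \<bar>g0 x - g1 x\<bar> \<le> \<epsilon>"
    and tail: "emeasure (density lborel g0) {x. R < \<bar>x\<bar>} \<le> ennreal \<tau>"
    and R: "0 \<le> R" and \<tau>: "0 \<le> \<tau>"
  shows "ennreal (1 - 2 * R * \<epsilon> - \<tau>) \<le> (\<integral>\<^sup>+x. min (ennreal (g0 x)) (ennreal (g1 x)) \<partial>lborel)"
proof -
  let ?m = "\<lambda>x. min (ennreal (g0 x)) (ennreal (g1 x))"
  have \<epsilon>: "0 \<le> \<epsilon>" using eps[of 0] by linarith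
  have pt: "ennreal (g0 x) \<le> ?m x + (ennreal \<epsilon> * indicator {-R..R} x + ennreal (g0 x) * indicator {x. R < \<bar>x\<bar>} x)" for x
  proof (cases "R < \<bar>x\<bar>")
    case True
    then show ?thesis by (auto simp: indicator_def intro: add_increasing)
  next
    case False
    then have "x \<in> {-R..R}" by auto
    moreover have "g0 x \<le> min (g0 x) (g1 x) + \<epsilon>" using eps[of x] \<epsilon> by auto
    then have "ennreal (g0 x) \<le> ennreal (min (g0 x) (g1 x) + \<epsilon>)" by (rule ennreal_leI)
    then have "ennreal (g0 x) \<le> ?m x + ennreal \<epsilon>"
      using nn \<epsilon> by (subst (asm) ennreal_plus) (auto simp: min_def split: if_splits)
    ultimately show ?thesis using False by (auto simp: indicator_def)
  qed
  have "1 \<le> (\<integral>\<^sup>+x. ?m x + (ennreal \<epsilon> * indicator {-R..R} x + ennreal (g0 x) * indicator {x. R < \<bar>x\<bar>} x) \<partial>lborel)"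
    unfolding one[symmetric] by (intro nn_integral_mono pt)
  also have "\<dots> = (\<integral>\<^sup>+x. ?m x \<partial>lborel) + ((\<integral>\<^sup>+x. ennreal \<epsilon> * indicator {-R..R} x \<partial>lborel)
      + emeasure (density lborel g0) {x. R < \<bar>x\<bar>})"
    by (subst nn_integral_add, measurable)+ (simp add: emeasure_density)
  also have "\<dots> \<le> (\<integral>\<^sup>+x. ?m x \<partial>lborel) + (ennreal (2 * R * \<epsilon>) + ennreal \<tau>)"
    using R \<epsilon> by (intro add_mono order_refl tail)
      (simp add: nn_integral_cmult ennreal_mult[symmetric] ac_simps)
  also have "\<dots> = (\<integral>\<^sup>+x. ?m x \<partial>lborel) + ennreal (2 * R * \<epsilon> + \<tau>)"
    using R \<epsilon> \<tau> by simp
  finally have *: "1 \<le> (\<integral>\<^sup>+x. ?m x \<partial>lborel) + ennreal (2 * R * \<epsilon> + \<tau>)" .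
  show ?thesis
  \<comment> \<open>The case split moves the subtraction from the extended reals to the reals;
    infinite mass is trivial.\<close>
  proof (cases "\<integral>\<^sup>+x. ?m x \<partial>lborel")
    case (real r)
    with * have "ennreal 1 \<le> ennreal (r + (2 * R * \<epsilon> + \<tau>))"
      using R \<epsilon> \<tau> by simp
    then have "1 \<le> r + (2 * R * \<epsilon> + \<tau>)" using real R \<epsilon> \<tau> by (subst (asm) ennreal_le_iff) auto
    with real show ?thesis by (auto intro: ennreal_leI)
  qed simp
qed

lemma X_density_spiked:
  assumes "0 < m" "0 < L" "0 \<le> \<eta>"
  shows "X_density (1/2 - \<eta>) (spiked_density m \<eta> L) x = (1/2 - \<eta>) * std_normal_density x
    + (\<integral>v. fejer m v * std_normal_density (x - v) \<partial>lborel) / 2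
    + \<eta> * (\<integral>v. fejer L v * std_normal_density (x - v) \<partial>lborel)"
proof -
  have "(\<integral>v. spiked_density m \<eta> L v * std_normal_density (x - v) \<partial>lborel)
    = (\<integral>v. (fejer m v * std_normal_density (x - v) / 2 + \<eta> * (fejer L v * std_normal_density (x - v))) / (1/2 + \<eta>) \<partial>lborel)"
    by (intro Bochner_Integration.integral_cong refl)
       (simp add: spiked_density_def algebra_simps add_divide_distrib)
  also have "\<dots> = ((\<integral>v. fejer m v * std_normal_density (x - v) \<partial>lborel) / 2
    + \<eta> * (\<integral>v. fejer L v * std_normal_density (x - v) \<partial>lborel)) / (1/2 + \<eta>)"
    using integrable_mult_std_normal_density[OF integrable_fejer[OF assms(1)], of x]
      integrable_mult_std_normal_density[OF integrable_fejer[OF assms(2)], of x]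
    by simp
  finally show ?thesis using assms(3) unfolding X_density_def by simp
qed

section \<open>The lower bound\<close>

text \<open>With the cutoff R = n S, the choice of S makes the tail loss 1/(4n), and the condition
  on M makes the loss on [-R, R] at most 1/(4n). The overlap is thus at least 1 - 1/(2n), and its
  n-th power at least 1/2.\<close>

lemma spiked_two_point_bound:
  assumes m: "0 < m" and M: "1 \<le> M" and \<delta>: "0 \<le> \<delta>" "\<delta> \<le> 1/4"
    and n: "0 < n"
    and S: "S = 4 * (4 * (2 / (fejer_mass * m) + 2 / fejer_mass) + 24)"
    and M2: "exp (- M\<^sup>2 / 4) \<le> 1 / (16 * S * (real n)\<^sup>2)"
    and T: "T \<in> estimators n"
  shows "ennreal (\<delta>\<^sup>2 / 4)
    \<le> sq_risk std_normal_distribution n T (spiked_density m \<delta> M) (1/2 - \<delta>)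
      + sq_risk std_normal_distribution n T (spiked_density m (2 * \<delta>) (2 * M)) (1/2 - 2 * \<delta>)"
proof -
  let ?f0 = "spiked_density m \<delta> M" and ?f1 = "spiked_density m (2 * \<delta>) (2 * M)"
  let ?p0 = "1/2 - \<delta>" and ?p1 = "1/2 - 2 * \<delta>"
  define g0 where "g0 = X_density ?p0 ?f0"
  define g1 where "g1 = X_density ?p1 ?f1"
  define B where "B = 2 / (fejer_mass * m) + 2 / fejer_mass"
  define R where "R = real n * S"
  have B: "0 \<le> B" unfolding B_def using m fejer_mass_pos by simp
  then have S96: "96 \<le> S" and SB: "S = 4 * (4 * B + 24)" unfolding S by (auto simp: B_def)
  have R: "1 \<le> R"
  proof -
    have "1 * 1 \<le> real n * S" using n S96 by (intro mult_mono) auto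
    then show ?thesis by (simp add: R_def)
  qed
  have f0: "prob_density ?f0" and f1: "prob_density ?f1"
    using m M \<delta> by (auto intro!: prob_density_spiked)
  have p0: "0 \<le> ?p0" "?p0 \<le> 1" and p1: "0 \<le> ?p1" "?p1 \<le> 1" using \<delta> by auto
  have X0: "X_law std_normal_distribution ?p0 ?f0 = density lborel (\<lambda>x. ennreal (g0 x))"
    and X1: "X_law std_normal_distribution ?p1 ?f1 = density lborel (\<lambda>x. ennreal (g1 x))"
    unfolding g0_def g1_def using f0 f1 p0 p1 by (auto intro!: X_law_eq_density)
  have [measurable]: "g0 \<in> borel_measurable borel" "g1 \<in> borel_measurable borel"
    unfolding g0_def g1_def using f0 f1 by (auto intro: borel_measurable_X_density)
  have nn: "0 \<le> g0 x" "0 \<le> g1 x" for x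
    unfolding g0_def g1_def using f0 f1 p0 p1 by (auto intro!: X_density_nonneg)
  have P0: "prob_space (density lborel (\<lambda>x. ennreal (g0 x)))"
    unfolding X0[symmetric] by (rule prob_space_X_law[OF f0 p0]) (auto intro: prob_space_normal_density)
  have P1: "prob_space (density lborel (\<lambda>x. ennreal (g1 x)))"
    unfolding X1[symmetric] by (rule prob_space_X_law[OF f1 p1]) (auto intro: prob_space_normal_density)
  have one: "(\<integral>\<^sup>+x. ennreal (g0 x) \<partial>lborel) = 1"
    using prob_space.emeasure_space_1[OF P0] by (simp add: emeasure_density)
  have eps: "\<bar>g0 x - g1 x\<bar> \<le> 2 * exp (- M\<^sup>2 / 4)" for x
  proof -
    let ?c = "\<lambda>L. \<integral>v. fejer L v * std_normal_density (x - v) \<partial>lborel"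
    \<comment> \<open>The fixed component F_m cancels; the coefficients of the atom, F_M and F_2M
      that remain are \<delta>, \<delta> and -2\<delta>.\<close>
    have "g0 x - g1 x = \<delta> * (std_normal_density x + ?c M - 2 * ?c (2 * M))"
      unfolding g0_def g1_def using m M \<delta>
      by (subst (1 2) X_density_spiked) (auto simp: algebra_simps)
    then have "\<bar>g0 x - g1 x\<bar> = \<delta> * \<bar>std_normal_density x + ?c M - 2 * ?c (2 * M)\<bar>"
      using \<delta> by (simp add: abs_mult)
    \<comment> \<open>The factor \<delta> is given away, since the exponential alone is small
      enough.\<close>
    also have "\<dots> \<le> 1 * (sqrt 2 * exp (- M\<^sup>2 / 4))"
      using \<delta> M by (intro mult_mono gaussian_spike_difference_le) auto
    also have "\<dots> \<le> 2 * exp (- M\<^sup>2 / 4)"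
      by (simp add: real_le_lsqrt)
    finally show ?thesis .
  qed
  have "emeasure (density lborel (\<lambda>x. ennreal (g0 x))) {x. R < \<bar>x\<bar>} \<le> ennreal ((4 * B + 24) / R)"
    unfolding X0[symmetric] using m M \<delta> B R
    by (intro X_law_tail_le f0 p0) (auto simp: B_def intro!: spiked_density_le)
  then have mass: "ennreal (1 - 2 * R * (2 * exp (- M\<^sup>2 / 4)) - (4 * B + 24) / R)
      \<le> (\<integral>\<^sup>+x. min (ennreal (g0 x)) (ennreal (g1 x)) \<partial>lborel)"
    using R B by (intro min_density_mass_ge nn one eps) auto
  have "(4 * B + 24) / R = 1 / (4 * real n)"
    using n B unfolding R_def SB by (simp add: field_simps add_nonneg_eq_0_iff)
  moreover have "2 * R * (2 * exp (- M\<^sup>2 / 4)) \<le> 1 / (4 * real n)"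
  proof -
    have "2 * R * (2 * exp (- M\<^sup>2 / 4)) \<le> 2 * R * (2 * (1 / (16 * S * (real n)\<^sup>2)))"
      using R M2 by (intro mult_left_mono) auto
    also have "\<dots> = 1 / (4 * real n)"
      using n S96 by (simp add: R_def power2_eq_square field_simps)
    finally show ?thesis .
  qed
  ultimately have "1 - 1 / (2 * real n) \<le> 1 - 2 * R * (2 * exp (- M\<^sup>2 / 4)) - (4 * B + 24) / R"
    by (simp add: field_simps)
  then have "ennreal (1 - 1 / (2 * real n)) \<le> (\<integral>\<^sup>+x. min (ennreal (g0 x)) (ennreal (g1 x)) \<partial>lborel)"
    using mass by (rule order_trans[OF ennreal_leI])
  then have "ennreal (1 - 1 / (2 * real n)) ^ n \<le> (\<integral>\<^sup>+x. min (ennreal (g0 x)) (ennreal (g1 x)) \<partial>lborel) ^ n"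
    by (intro power_mono) auto
  \<comment> \<open>Bernoulli's inequality at -1/(2n) gives 1 - n/(2n).\<close>
  moreover have "1 / 2 \<le> (1 - 1 / (2 * real n)) ^ n"
    using Bernoulli_inequality[of "- (1 / (2 * real n))" n] n by (simp add: field_simps)
  then have "ennreal (1 / 2) \<le> ennreal (1 - 1 / (2 * real n)) ^ n"
    using n by (subst ennreal_power) (simp, rule ennreal_leI)
  ultimately have half: "ennreal (1 / 2) \<le> (\<integral>\<^sup>+x. min (ennreal (g0 x)) (ennreal (g1 x)) \<partial>lborel) ^ n"
    by (rule order_trans[rotated])
  have "ennreal (\<delta>\<^sup>2 / 4) = ennreal ((?p0 - ?p1)\<^sup>2 / 2) * ennreal (1 / 2)"
    by (subst ennreal_mult[symmetric]) auto
  also have "\<dots> \<le> ennreal ((?p0 - ?p1)\<^sup>2 / 2)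
      * (\<integral>\<^sup>+x. min (ennreal (g0 x)) (ennreal (g1 x)) \<partial>lborel) ^ card {1..n}"
    using half by (intro mult_left_mono) auto
  also have "\<dots> \<le> (\<integral>\<^sup>+x. ennreal ((T x - ?p0)\<^sup>2) \<partial>PiM {1..n} (\<lambda>_. density lborel (\<lambda>x. ennreal (g0 x))))
      + (\<integral>\<^sup>+x. ennreal ((T x - ?p1)\<^sup>2) \<partial>PiM {1..n} (\<lambda>_. density lborel (\<lambda>x. ennreal (g1 x))))"
    using T by (intro two_point_risk_bound P0 P1) (auto simp: estimators_def)
  finally show ?thesis
    unfolding sq_risk_def sample_law_def X0 X1 .
qed

theorem theorem4:
  fixes \<alpha> K\<^sub>\<Sigma> :: real
  assumes "\<alpha> > 0" and "K\<^sub>\<Sigma> > 0"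
  shows "\<exists>c::real. c > 0 \<and> (\<forall>n::nat. n \<ge> 2 \<longrightarrow>
    (INF T\<in>estimators n. SUP (f, p)\<in>Sobolev_densities \<alpha> K\<^sub>\<Sigma> \<times> {0..<1}.
       sq_risk std_normal_distribution n T f p)
    \<ge> ennreal (c * (ln (real n)) powr (- (\<alpha> + 1/2))))"
proof -
  define K where "K = K\<^sub>\<Sigma>"
  have K: "0 < K" using assms by (simp add: K_def)
  \<comment> \<open>Half of the Sobolev budget goes to the fixed component: 4m(1 + m^(2\<alpha>))
    \<le> 8m \<le> K/2.\<close>
  define m where "m = min 1 (K / 16)"
  have m: "0 < m" "m \<le> 1" "16 * m \<le> K" using K by (auto simp: m_def)
  define S where "S = 4 * (4 * (2 / (fejer_mass * m) + 2 / fejer_mass) + 24)"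
  have S: "96 \<le> S" unfolding S_def using m fejer_mass_pos by simp
  \<comment> \<open>Here 2^s = 16 S, hence 16 S \<le> n^s for all n \<ge> 2. With
    \<open>\<kappa>\<close> as below, M^2/4 will equal (2 + s) ln n, which dominates ln(16 S
    n^2).\<close>
  define s where "s = ln (16 * S) / ln 2"
  define \<kappa> where "\<kappa> = 8 + 4 * s"
  have s: "0 \<le> s" using S by (simp add: s_def)
  have \<kappa>: "8 \<le> \<kappa>" using s by (simp add: \<kappa>_def)
  \<comment> \<open>The square root spends the other half of the Sobolev budget on the spike; the
    cap 1/8 keeps \<delta> \<le> 1/8, so both values of p stay in [0,1).\<close>
  define c0 where "c0 = min (1/8) (sqrt (K / (512 * 2 powr (2 * \<alpha>))))"
  have c0: "0 < c0" "c0 \<le> 1/8" using K by (auto simp: c0_def)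
  have c0K: "256 * 2 powr (2 * \<alpha>) * c0\<^sup>2 \<le> K / 2"
  proof -
    have "c0\<^sup>2 \<le> (sqrt (K / (512 * 2 powr (2 * \<alpha>))))\<^sup>2"
      using c0 by (intro power_mono) (auto simp: c0_def)
    also have "\<dots> = K / (512 * 2 powr (2 * \<alpha>))" using K by simp
    finally show ?thesis by (simp add: field_simps)
  qed
  \<comment> \<open>Chosen so that the claimed rate equals \<delta>^2/8 exactly.\<close>
  define c where "c = c0\<^sup>2 * \<kappa> powr (- (\<alpha> + 1/2)) / 8"
  have "0 < c" using c0 \<kappa> by (simp add: c_def)
  moreover have "ennreal (c * (ln (real n)) powr (- (\<alpha> + 1/2)))
     \<le> (INF T\<in>estimators n. SUP (f, p)\<in>Sobolev_densities \<alpha> K \<times> {0..<1}.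
       sq_risk std_normal_distribution n T f p)" if n: "2 \<le> n" for n :: nat
  proof (rule INF_greatest)
    fix T assume T: "T \<in> estimators n"
    define W where "W = \<kappa> * ln (real n)"
    define M where "M = sqrt W"
    \<comment> \<open>The power of W makes \<delta>^2 M^(2\<alpha>+1) equal to c0^2, the largest
      order of \<delta> that this Sobolev estimate permits.\<close>
    define \<delta> where "\<delta> = c0 * W powr (- (\<alpha> + 1/2) / 2)"
    have ln: "ln 2 \<le> ln (real n)" using n by simp
    have W: "1 \<le> W"
    proof -
      have "8 * (2/3) \<le> \<kappa> * ln (real n)"
        using \<kappa> ln ln2_ge_two_thirds by (intro mult_mono) auto
      then show ?thesis by (simp add: W_def)
    qed
    have M: "1 \<le> M" "M\<^sup>2 = W" using W by (auto simp: M_def)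
    have \<delta>: "0 < \<delta>" "\<delta> \<le> 1/8"
    proof -
      show "0 < \<delta>" using c0 W by (simp add: \<delta>_def)
      have "W powr (- (\<alpha> + 1/2) / 2) \<le> W powr 0"
        using W assms(1) by (intro powr_mono) auto
      then have "\<delta> \<le> 1/8 * 1" unfolding \<delta>_def using c0 W by (intro mult_mono) auto
      then show "\<delta> \<le> 1/8" by simp
    qed
    have \<delta>2: "\<delta>\<^sup>2 = c0\<^sup>2 * W powr (- (\<alpha> + 1/2))"
      using W by (simp add: \<delta>_def power_mult_distrib power2_eq_square powr_add[symmetric])
    have small: "exp (- M\<^sup>2 / 4) \<le> 1 / (16 * S * (real n)\<^sup>2)"
    proof -
      have "ln (16 * S) = s * ln 2" by (simp add: s_def)
      also have "\<dots> \<le> s * ln (real n)" using ln s by (rule mult_left_mono)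
      finally have "ln (16 * S * (real n)\<^sup>2) \<le> M\<^sup>2 / 4"
        using n S by (simp add: ln_mult ln_realpow M W_def \<kappa>_def algebra_simps)
      then have "16 * S * (real n)\<^sup>2 \<le> exp (M\<^sup>2 / 4)"
        using n S by (simp add: ln_ge_iff flip: ln_le_cancel_iff[of _ "exp (M\<^sup>2 / 4)"])
      then show ?thesis using n S by (simp add: exp_minus field_simps)
    qed
    \<comment> \<open>The ranges of \<open>\<eta>\<close> and \<open>L\<close> cover both hypotheses
      at once. The constant 256 below is 16 times 4 from (2\<delta>)^2, 2 from 2M, and 2 from
      absorbing the 1 in the weight.\<close>
    have sob: "spiked_density m \<eta> L \<in> Sobolev_densities \<alpha> K"
      if \<eta>: "0 \<le> \<eta>" "\<eta> \<le> 2 * \<delta>" and L: "1 \<le> L" "L \<le> 2 * M" for \<eta> L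
    proof (rule spiked_density_Sobolev)
      have "m powr (2 * \<alpha>) \<le> 1 powr (2 * \<alpha>)" using m assms by (intro powr_mono2) auto
      then have "4 * m * (1 + m powr (2 * \<alpha>)) \<le> 4 * m * 2" using m by (intro mult_left_mono) auto
      moreover have "16 * \<eta>\<^sup>2 * L * (1 + L powr (2 * \<alpha>)) \<le> K / 2"
      proof -
        have "1 \<le> (2 * M) powr (2 * \<alpha>)" using M assms by (intro ge_one_powr_ge_zero) auto
        moreover have "L powr (2 * \<alpha>) \<le> (2 * M) powr (2 * \<alpha>)" using L assms by (intro powr_mono2) auto
        ultimately have "1 + L powr (2 * \<alpha>) \<le> 2 * (2 * M) powr (2 * \<alpha>)" by simp
        moreover have "\<eta>\<^sup>2 \<le> (2 * \<delta>)\<^sup>2" using \<eta> by (intro power_mono)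
        ultimately have "16 * \<eta>\<^sup>2 * L * (1 + L powr (2 * \<alpha>))
          \<le> 16 * (2 * \<delta>)\<^sup>2 * (2 * M) * (2 * (2 * M) powr (2 * \<alpha>))"
          using L M by (intro mult_mono) auto
        also have "\<dots> = 256 * 2 powr (2 * \<alpha>) * (\<delta>\<^sup>2 * (M * M powr (2 * \<alpha>)))"
          using M by (simp add: powr_mult power_mult_distrib)
        also have "M * M powr (2 * \<alpha>) = W powr (\<alpha> + 1/2)"
        proof -
          have "M = W powr (1/2)" using W by (simp add: M_def powr_half_sqrt)
          then show ?thesis by (simp add: powr_powr powr_add[symmetric] add.commute)
        qed
        also have "\<delta>\<^sup>2 * W powr (\<alpha> + 1/2) = c0\<^sup>2"
          using W by (simp add: \<delta>2 mult.assoc powr_add[symmetric])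
        finally show ?thesis using c0K by (rule order_trans)
      qed
      ultimately show "4 * m * (1 + m powr (2 * \<alpha>)) + 16 * \<eta>\<^sup>2 * L * (1 + L powr (2 * \<alpha>)) \<le> K"
        using m by linarith
    qed (use m L \<eta> assms in auto)
    let ?S = "SUP (f, p)\<in>Sobolev_densities \<alpha> K \<times> {0..<1}. sq_risk std_normal_distribution n T f p"
    have up: "sq_risk std_normal_distribution n T f p \<le> ?S"
      if "f \<in> Sobolev_densities \<alpha> K" "0 \<le> p" "p < 1" for f p
      using that by (intro SUP_upper2[of "(f, p)"]) auto
    have "ennreal (\<delta>\<^sup>2 / 4) \<le> sq_risk std_normal_distribution n T (spiked_density m \<delta> M) (1/2 - \<delta>)
      + sq_risk std_normal_distribution n T (spiked_density m (2 * \<delta>) (2 * M)) (1/2 - 2 * \<delta>)"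
      using m M \<delta> n small T by (intro spiked_two_point_bound[where S=S]) (auto simp: S_def)
    also have "\<dots> \<le> ?S + ?S"
      using \<delta> M by (intro add_mono up sob) auto
    finally have "ennreal (\<delta>\<^sup>2 / 4) \<le> ?S + ?S" .
    \<comment> \<open>Halving is done in the reals, since the supremum may be infinite.\<close>
    then have "ennreal (\<delta>\<^sup>2 / 8) \<le> ?S"
    proof (cases ?S)
      case (real r)
      with \<open>ennreal (\<delta>\<^sup>2 / 4) \<le> ?S + ?S\<close> have "\<delta>\<^sup>2 / 4 \<le> r + r"
        by (simp add: ennreal_plus[symmetric] del: ennreal_plus)
      with real show ?thesis by (auto intro!: ennreal_leI)
    next
      case top
      then show ?thesis by (simp only: top_greatest)
    qed
    moreover have "c * (ln (real n)) powr (- (\<alpha> + 1/2)) = \<delta>\<^sup>2 / 8"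
      using \<kappa> n by (simp add: c_def \<delta>2 W_def powr_mult)
    ultimately show "ennreal (c * (ln (real n)) powr (- (\<alpha> + 1/2))) \<le> ?S" by (simp only:)
  qed
  ultimately show ?thesis unfolding K_def by blast
qed

end
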